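(* Let $\mathcal{T}$ and $\mathcal{X}$ be countably generated measurable spaces, e.g. $\mathcal{T}=[0,1],\mathbb{N},\mathbb{R}$ and $\mathcal{X}=\mathbb{R}^d$. Let $X^{(1)}_t,\dots,X^{(M)}_t,\dots$ be i.i.d. measurable $\mathcal{X}$-valued stochastic processes over $\mathcal{T}$, and let $P_T$ be any probability measure on $\mathcal{T}$. Let $T_1,\dots,T_M,\dots\sim P_T$ be i.i.d. and denote $X_i = X^{(i)}_{T_i}$, i.e. $X_i(\omega)=X^{(i)}_{T_i(\omega)}(\omega)$. Let $\mathbb{P}_{X_t}$ denote the common distribution of the $X^{(i)}_t$ on $\mathcal{X}$. Then all $(T_i,X_i)$ are i.i.d. and $X_i\mid[T_i=t]\sim\mathbb{P}_{X_t}$ for all $t\in\mathcal{T}$, i.e. they form a sample of the drift process $(\mathbb{P}_{X_t},P_T)$. Furthermore, $(\mathbb{P}_{X_t},P_T)$ has no drift if and only if there exists a $P_T$-null set $N\subset\mathcal{T}$ such that $X_t$ restricted to $\mathcal{T}\setminus N$ is stationary.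
   Context: Let $(\Omega,\mathcal{A},\mathbb{P})$ be a probability space, and let $\Sigma_{\mathcal{T}}$ be the $\sigma$-algebra of $\mathcal{T}$. An $\mathcal{X}$-valued stochastic process over $\mathcal{T}$ is a map $X_\bullet:\mathcal{T}\times\Omega\to\mathcal{X}$ such that $X_t:\Omega\to\mathcal{X}$ is an $\mathcal{X}$-valued random variable for every $t\in\mathcal{T}$. It is called measurable iff $X_\bullet$ is measurable with respect to the product $\sigma$-algebra of $\mathcal{A}$ and $\Sigma_{\mathcal{T}}$. A stochastic process over an index set $\mathcal{T}'$ is called stationary iff the distribution of $X_t$ is time invariant, i.e. $\mathbb{P}[X_t\in A]=\mathbb{P}[X_s\in A]$ for all $s,t\in\mathcal{T}'$ and all measurable $A\subset\mathcal{X}$. In the second part of the claim, $X_t$ denotes a generic copy of the processes $X^{(i)}_t$. A drift process $(\mathcal{D}_t,P_T)$ during $\mathcal{T}$ on $\mathcal{X}$ is a probability distribution $P_T$ on $\mathcal{T}$ together with a Markov kernel $\mathcal{D}_t$ from $\mathcal{T}$ to $\mathcal{X}$. A sample of it consists of i.i.d. pairs $(T_i,X_i)$ with $T_i\sim P_T$ and $X_i\mid[T_i=t]\sim\mathcal{D}_t$, where the latter means that $\mathcal{D}_t$ is the conditional distribution of $X_i$ given $T_i=t$, i.e. $\mathbb{P}[X_i\in A,\,T_i\in W]=\int_W\mathcal{D}_t(A)\,\mathrm{d}P_T(t)$ for all measurable $A\subset\mathcal{X}$, $W\subset\mathcal{T}$. The drift process $(\mathcal{D}_t,P_T)$ has drift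 iff the probability of observing two different distributions in one sample is larger than $0$, i.e. $\mathbb{P}_{T,S\sim P_T}[\mathcal{D}_T\neq\mathcal{D}_S]>0$ for independent $T,S\sim P_T$; otherwise it has no drift.
   Formalization: Added: each process is measurable with respect to its own σ-algebra, and these σ-algebras and the times T_j are all mutually independent. Without independence the claim fails, e.g. for X^{(i)}_t = T_i with T_i fair Bernoulli. *)

theory Defs
  imports "HOL-Probability.Probability"
begin

definition countably_generated :: "'a measure \<Rightarrow> bool" where
  "countably_generated S \<longleftrightarrow>
     (\<exists>C. countable C \<and> C \<subseteq> Pow (space S) \<and> sets S = sigma_sets (space S) C)"

text \<open>A process over the index space \<open>ST\<close> is a curried map \<open>X\<close>; only the values \<open>X t \<omega>\<close> with
  \<open>t \<in> space ST\<close> and \<open>\<omega> \<in> space M\<close> matter.\<close>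

definition stochastic_process ::
  "'w measure \<Rightarrow> 't measure \<Rightarrow> 'x measure \<Rightarrow> ('t \<Rightarrow> 'w \<Rightarrow> 'x) \<Rightarrow> bool" where
  "stochastic_process M ST SX X \<longleftrightarrow> (\<forall>t\<in>space ST. X t \<in> M \<rightarrow>\<^sub>M SX)"

definition measurable_process ::
  "'w measure \<Rightarrow> 't measure \<Rightarrow> 'x measure \<Rightarrow> ('t \<Rightarrow> 'w \<Rightarrow> 'x) \<Rightarrow> bool" where
  "measurable_process M ST SX X \<longleftrightarrow>
     stochastic_process M ST SX X \<and> (\<lambda>(t, \<omega>). X t \<omega>) \<in> (ST \<Otimes>\<^sub>M M) \<rightarrow>\<^sub>M SX"

definition stationary_on ::
  "'w measure \<Rightarrow> 'x measure \<Rightarrow> 't set \<Rightarrow> ('t \<Rightarrow> 'w \<Rightarrow> 'x) \<Rightarrow> bool" where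
  "stationary_on M SX T' X \<longleftrightarrow>
     (\<forall>s\<in>T'. \<forall>t\<in>T'. \<forall>A\<in>sets SX.
        measure M {\<omega>\<in>space M. X t \<omega> \<in> A} = measure M {\<omega>\<in>space M. X s \<omega> \<in> A})"

definition process_law ::
  "'w measure \<Rightarrow> 't measure \<Rightarrow> 'x measure \<Rightarrow> ('t \<Rightarrow> 'w \<Rightarrow> 'x) \<Rightarrow> ('t \<Rightarrow> 'x) measure" where
  "process_law M ST SX X =
     distr M (\<Pi>\<^sub>M t\<in>space ST. SX) (\<lambda>\<omega>. \<lambda>t\<in>space ST. X t \<omega>)"

text \<open>Joint independence of the processes \<open>X 0, X 1, \<dots>\<close> and the random times \<open>T 0, T 1, \<dots>\<close>.
  Each process carries its own randomness, a sub-\<open>\<sigma>\<close>-algebra \<open>F i\<close> for which it is a measurable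
  process, and all the \<open>F i\<close> and \<open>\<sigma>(T j)\<close> are mutually independent.

  Independence of the \<open>\<sigma>\<close>-algebras generated by the variables \<open>X i t\<close> (which follows from this)
  would not be enough to evaluate a process at a random time: for \<open>\<Omega> = [0,1]\<close> with Lebesgue
  measure, \<open>T \<omega> = \<omega>\<close> and \<open>X t \<omega> = (if \<omega> = t then 1 else 0)\<close>, the process \<open>X\<close> is measurable and
  generates only events of probability 0 or 1, hence is independent of \<open>T\<close> in that sense,
  and \<open>X t = 0\<close> almost surely for every \<open>t\<close>, but \<open>X (T \<omega>) \<omega> = 1\<close> for every \<open>\<omega>\<close>.\<close>

definition indep_processes_and_times ::
  "'w measure \<Rightarrow> 't measure \<Rightarrow> 'x measure \<Rightarrow> (nat \<Rightarrow> 't \<Rightarrow> 'w \<Rightarrow> 'x) \<Rightarrow> (nat \<Rightarrow> 'w \<Rightarrow> 't) \<Rightarrow> bool" where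
  "indep_processes_and_times M ST SX X T \<longleftrightarrow>
     (\<exists>F :: nat \<Rightarrow> 'w measure.
        (\<forall>i. subalgebra M (F i) \<and> measurable_process (F i) ST SX (X i)) \<and>
        prob_space.indep_sets M
          (case_sum (\<lambda>i. sets (F i)) (\<lambda>j. {T j -` W \<inter> space M | W. W \<in> sets ST}))
          (UNIV :: (nat + nat) set))"

text \<open>Membership in \<^term>\<open>ST \<rightarrow>\<^sub>M prob_algebra SX\<close> says that \<open>D\<close> is a Markov kernel.\<close>

definition drift_process ::
  "'t measure \<Rightarrow> 'x measure \<Rightarrow> ('t \<Rightarrow> 'x measure) \<Rightarrow> 't measure \<Rightarrow> bool" where
  "drift_process ST SX D PT \<longleftrightarrow>
     prob_space PT \<and> sets PT = sets ST \<and> D \<in> ST \<rightarrow>\<^sub>M prob_algebra SX"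

definition has_cond_distr ::
  "'w measure \<Rightarrow> 't measure \<Rightarrow> 'x measure \<Rightarrow> ('t \<Rightarrow> 'x measure) \<Rightarrow> 't measure
     \<Rightarrow> ('w \<Rightarrow> 't) \<Rightarrow> ('w \<Rightarrow> 'x) \<Rightarrow> bool" where
  "has_cond_distr M ST SX D PT T Y \<longleftrightarrow>
     (\<forall>A\<in>sets SX. \<forall>W\<in>sets ST.
        emeasure M {\<omega>\<in>space M. Y \<omega> \<in> A \<and> T \<omega> \<in> W} = (\<integral>\<^sup>+t\<in>W. emeasure (D t) A \<partial>PT))"

definition iid_vars ::
  "'w measure \<Rightarrow> 'a measure \<Rightarrow> (nat \<Rightarrow> 'w \<Rightarrow> 'a) \<Rightarrow> bool" where
  "iid_vars M S Z \<longleftrightarrow>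
     prob_space.indep_vars M (\<lambda>_. S) Z UNIV \<and> (\<forall>i j. distr M S (Z i) = distr M S (Z j))"

definition drift_process_sample ::
  "'w measure \<Rightarrow> 't measure \<Rightarrow> 'x measure \<Rightarrow> ('t \<Rightarrow> 'x measure) \<Rightarrow> 't measure
     \<Rightarrow> (nat \<Rightarrow> 'w \<Rightarrow> 't) \<Rightarrow> (nat \<Rightarrow> 'w \<Rightarrow> 'x) \<Rightarrow> bool" where
  "drift_process_sample M ST SX D PT T Y \<longleftrightarrow>
     iid_vars M (ST \<Otimes>\<^sub>M SX) (\<lambda>i \<omega>. (T i \<omega>, Y i \<omega>)) \<and>
     (\<forall>i. distr M ST (T i) = PT) \<and>
     (\<forall>i. has_cond_distr M ST SX D PT (T i) (Y i))"

definition has_drift :: "('t \<Rightarrow> 'x measure) \<Rightarrow> 't measure \<Rightarrow> bool" where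
  "has_drift D PT \<longleftrightarrow>
     measure (PT \<Otimes>\<^sub>M PT) {(t, s) \<in> space (PT \<Otimes>\<^sub>M PT). D t \<noteq> D s} > 0"

end

(* Let F i be the sigma-algebra carrying the i-th process. Independence of F i and T i means that
   the law of (T i \<omega>, \<omega>) on ST \<Otimes> F i is a product measure, so evaluating the jointly measurable
   process at the random time reduces to Fubini's theorem. Each pair (T i, X i) is measurable for
   the sigma-algebra generated by F i and T i, and these are independent over i.
   As SX has a countable generator that is closed under intersections, {(t, s). D t \<noteq> D s} is
   measurable. Hence absence of drift means that D is almost surely equal to one fixed D t0. *)

theory Submission
  imports Defs
begin

section \<open>Drift of a kernel into a countably generated space\<close>

text \<open>A countable family has only countably many finite subfamilies, so closing a countable
  generator under finite intersections keeps it countable. The result is a pi-system, on which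
  equality of probability measures can be tested.\<close>

lemma countably_generated_Int_stable:
  assumes "countably_generated S"
  obtains E where "countable E" "E \<subseteq> Pow (space S)" "Int_stable E" "space S \<in> E"
    "sets S = sigma_sets (space S) E"
proof -
  obtain C where C: "countable C" "C \<subseteq> Pow (space S)" "sets S = sigma_sets (space S) C"
    using assms by (auto simp: countably_generated_def)
  \<comment> \<open>Intersecting with \<open>space S\<close> turns the empty subfamily into
    \<open>space S\<close> itself, which supplies the required member
    \<open>space S \<in> E\<close>.\<close>
  define E where "E = (\<lambda>K. space S \<inter> \<Inter>K) ` {K. finite K \<and> K \<subseteq> C}"
  have "countable E"
    unfolding E_def by (intro countable_image countable_Collect_finite_subset C)
  moreover have E_Pow: "E \<subseteq> Pow (space S)"
    by (auto simp: E_def)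
  moreover have "Int_stable E"
  proof (rule Int_stableI)
    fix a b assume "a \<in> E" "b \<in> E"
    then obtain K L where "finite K" "K \<subseteq> C" "a = space S \<inter> \<Inter>K"
      "finite L" "L \<subseteq> C" "b = space S \<inter> \<Inter>L"
      by (auto simp: E_def)
    then have "a \<inter> b = space S \<inter> \<Inter>(K \<union> L)" "finite (K \<union> L)" "K \<union> L \<subseteq> C"
      by auto
    then show "a \<inter> b \<in> E"
      unfolding E_def by blast
  qed
  moreover have "space S \<in> E"
    unfolding E_def by (rule image_eqI[of _ _ "{}"]) auto
  moreover have "sigma_sets (space S) C = sigma_sets (space S) E"
  proof (rule sigma_sets_eqI)
    fix a assume "a \<in> C"
    then have "a = space S \<inter> \<Inter>{a}" "{a} \<subseteq> C"
      using C(2) by auto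
    then have "a \<in> E"
      unfolding E_def by blast
    then show "a \<in> sigma_sets (space S) E"
      by (rule sigma_sets.Basic)
  next
    fix b assume "b \<in> E"
    then obtain K where K: "finite K" "K \<subseteq> C" "b = space S \<inter> \<Inter>K"
      by (auto simp: E_def)
    have "K \<subseteq> sets S"
      using K(2) C(3) by auto
    with K(1) have "space S \<inter> \<Inter>K \<in> sets S"
      by (induction K) (auto simp: Int_left_commute[of "space S"])
    then show "b \<in> sigma_sets (space S) C"
      using K(3) C(3) by simp
  qed
  ultimately show ?thesis
    using that[of E] C(3) by simp
qed

text \<open>Two probability measures on \<open>SX\<close> differ iff they differ on a member of a
  countable pi-system generating \<open>SX\<close>, so the set is a countable union of measurable
  sets. This matters for \<open>has_drift\<close>, because \<open>measure\<close> gives a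
  non-measurable set the default value 0.\<close>

lemma sets_kernel_differ:
  assumes "countably_generated SX" and D[measurable]: "D \<in> N \<rightarrow>\<^sub>M prob_algebra SX"
  shows "{(t, s) \<in> space (N \<Otimes>\<^sub>M N). D t \<noteq> D s} \<in> sets (N \<Otimes>\<^sub>M N)"
proof -
  obtain E where E: "countable E" "E \<subseteq> Pow (space SX)" "Int_stable E" "space SX \<in> E"
    "sets SX = sigma_sets (space SX) E"
    using countably_generated_Int_stable[OF assms(1)] .
  have D_eq: "D t = D s \<longleftrightarrow> (\<forall>A\<in>E. emeasure (D t) A = emeasure (D s) A)"
    if "t \<in> space N" "s \<in> space N" for t s
  proof -
    have prob: "prob_space (D r) \<and> sets (D r) = sets SX" if "r \<in> space N" for r
      using measurable_space[OF D that] by (simp add: space_prob_algebra)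
    interpret prob_space "D t" using prob that by blast
    show ?thesis
    proof
      assume "\<forall>A\<in>E. emeasure (D t) A = emeasure (D s) A"
      \<comment> \<open>A constant sequence serves as the cover by sets of finite measure, because
        \<open>space SX\<close> belongs to \<open>E\<close> and \<open>D t\<close> is a probability
        measure.\<close>
      then show "D t = D s"
        by (intro measure_eqI_generator_eq[OF E(3,2), where A = "\<lambda>_. space SX"])
           (use E prob that in auto)
    qed simp
  qed
  have "A \<in> sets SX" if "A \<in> E" for A
    using E(5) that by auto
  then have [measurable]: "(\<lambda>t. emeasure (D t) A) \<in> borel_measurable N" if "A \<in> E" for A
    using that measurable_emeasure_kernel[OF measurable_prob_algebraD[OF D]] by blast
  have "{(t, s) \<in> space (N \<Otimes>\<^sub>M N). D t \<noteq> D s} =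
      (\<Union>A\<in>E. {p \<in> space (N \<Otimes>\<^sub>M N). emeasure (D (fst p)) A \<noteq> emeasure (D (snd p)) A})"
    using D_eq by (auto simp: space_pair_measure)
  also have "\<dots> \<in> sets (N \<Otimes>\<^sub>M N)"
    using E(1) by (intro sets.countable_UN'') measurable
  finally show ?thesis .
qed

text \<open>If \<open>D t = D s\<close> for almost every pair, Fubini gives a point
  \<open>t0\<close> whose law is shared by almost every \<open>s\<close>, and the exceptional points
  form \<open>N\<close>. Conversely, a differing pair must have a coordinate in \<open>N\<close>,
  which confines it to two strips of product measure 0.\<close>

lemma not_has_drift_iff:
  assumes "countably_generated SX" and "drift_process ST SX D PT"
  shows "\<not> has_drift D PT \<longleftrightarrow>
    (\<exists>N\<in>null_sets PT. \<forall>s\<in>space ST - N. \<forall>t\<in>space ST - N. D s = D t)"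
proof -
  have PT: "prob_space PT" and sets_PT: "sets PT = sets ST"
    and D: "D \<in> PT \<rightarrow>\<^sub>M prob_algebra SX"
    using assms(2) by (auto simp: drift_process_def cong: measurable_cong_sets)
  have space_PT: "space PT = space ST"
    using sets_PT by (rule sets_eq_imp_space_eq)
  interpret PT: prob_space PT by fact
  interpret P: pair_prob_space PT PT ..
  let ?B = "{(t, s) \<in> space (PT \<Otimes>\<^sub>M PT). D t \<noteq> D s}"
  have B: "?B \<in> sets (PT \<Otimes>\<^sub>M PT)"
    using assms(1) D by (rule sets_kernel_differ)
  have "\<not> has_drift D PT \<longleftrightarrow> emeasure (PT \<Otimes>\<^sub>M PT) ?B = 0"
    by (simp add: has_drift_def P.emeasure_eq_measure less_le)
  also have "\<dots> \<longleftrightarrow> (\<exists>N\<in>null_sets PT. \<forall>s\<in>space ST - N. \<forall>t\<in>space ST - N. D s = D t)"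
  proof
    assume "emeasure (PT \<Otimes>\<^sub>M PT) ?B = 0"
    then have "AE p in PT \<Otimes>\<^sub>M PT. D (fst p) = D (snd p)"
      by (intro AE_I[OF _ _ B]) auto
    from P.AE_pair[OF this] have "AE t in PT. AE s in PT. D t = D s"
      by simp
    \<comment> \<open>The almost-everywhere filter of a probability measure is nontrivial, so a
      property that holds almost everywhere has a witness.\<close>
    then obtain t0 where "AE s in PT. D t0 = D s"
      using eventually_happens'[OF PT.ae_filter_bot] by blast
    then obtain N where "\<And>s. s \<in> space PT - N \<Longrightarrow> D t0 = D s" "N \<in> null_sets PT"
      by (rule AE_E3) blast
    then show "\<exists>N\<in>null_sets PT. \<forall>s\<in>space ST - N. \<forall>t\<in>space ST - N. D s = D t"
      using space_PT by metis
  next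
    assume "\<exists>N\<in>null_sets PT. \<forall>s\<in>space ST - N. \<forall>t\<in>space ST - N. D s = D t"
    then obtain N where N: "N \<in> null_sets PT"
      and eq: "\<And>s t. s \<in> space PT - N \<Longrightarrow> t \<in> space PT - N \<Longrightarrow> D s = D t"
      using space_PT by auto
    have "?B \<subseteq> N \<times> space PT \<union> space PT \<times> N"
      using eq by (auto simp: space_pair_measure)
    moreover have "N \<times> space PT \<union> space PT \<times> N \<in> null_sets (PT \<Otimes>\<^sub>M PT)"
      using N by (intro null_sets.Un) (auto simp: null_sets_def PT.emeasure_pair_measure_Times)
    ultimately show "emeasure (PT \<Otimes>\<^sub>M PT) ?B = 0"
      using null_sets_subset[OF _ B] by (intro null_setsD1) blast
  qed
  finally show ?thesis .
qed

section \<open>Evaluation of processes at random times\<close>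

text \<open>Pushing the constant kernel \<open>M\<close> forward along a jointly measurable map
  depends measurably on \<open>t\<close>; joint measurability is what makes the one-time laws a
  Markov kernel.\<close>

lemma measurable_process_kernel:
  assumes "prob_space M" and X: "measurable_process M ST SX X"
    and D: "\<And>t. t \<in> space ST \<Longrightarrow> distr M SX (X t) = D t"
  shows "D \<in> ST \<rightarrow>\<^sub>M prob_algebra SX"
proof -
  have "(\<lambda>_. M) \<in> ST \<rightarrow>\<^sub>M prob_algebra M"
    using assms(1) by (intro measurable_const) (simp add: space_prob_algebra)
  then have "(\<lambda>t. distr M SX (X t)) \<in> ST \<rightarrow>\<^sub>M prob_algebra SX"
    using X by (intro measurable_distr_prob_space2) (auto simp: measurable_process_def)
  \<comment> \<open>\<open>D\<close> is prescribed only on \<open>space ST\<close>, which is all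
    that measurability sees.\<close>
  then show ?thesis
    using D by (simp cong: measurable_cong)
qed

lemma measurable_process_random_time:
  assumes "measurable_process M ST SX X" and "T \<in> M \<rightarrow>\<^sub>M ST"
  shows "(\<lambda>\<omega>. X (T \<omega>) \<omega>) \<in> M \<rightarrow>\<^sub>M SX"
proof -
  have "(\<lambda>\<omega>. (T \<omega>, \<omega>)) \<in> M \<rightarrow>\<^sub>M ST \<Otimes>\<^sub>M M"
    using assms(2) by simp
  from measurable_compose[OF this, of "\<lambda>(t, \<omega>). X t \<omega>" SX] show ?thesis
    using assms(1) by (simp add: measurable_process_def)
qed

text \<open>Used to pass from the sigma-algebra carrying a process to a larger one for which the
  random time is measurable too.\<close>

lemma measurable_process_mono:
  assumes "subalgebra M F" and "measurable_process F ST SX X"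
  shows "measurable_process M ST SX X"
proof -
  have "(\<lambda>\<omega>. \<omega>) \<in> M \<rightarrow>\<^sub>M F"
    by (rule measurable_from_subalg[OF assms(1)]) simp
  then have id: "(\<lambda>p. (fst p, snd p)) \<in> ST \<Otimes>\<^sub>M M \<rightarrow>\<^sub>M ST \<Otimes>\<^sub>M F"
    by (intro measurable_Pair measurable_fst measurable_compose[OF measurable_snd])
  have "(\<lambda>p. X (fst p) (snd p)) \<in> ST \<Otimes>\<^sub>M F \<rightarrow>\<^sub>M SX"
    using assms(2) by (simp add: measurable_process_def split_beta')
  from measurable_compose[OF id this]
  have "(\<lambda>p. X (fst p) (snd p)) \<in> ST \<Otimes>\<^sub>M M \<rightarrow>\<^sub>M SX"
    by (simp only: fst_conv snd_conv)
  moreover have "X t \<in> M \<rightarrow>\<^sub>M SX" if "t \<in> space ST" for t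
    by (rule measurable_from_subalg[OF assms(1)])
      (use assms(2) that in \<open>simp add: measurable_process_def stochastic_process_def\<close>)
  ultimately show ?thesis
    by (simp add: measurable_process_def stochastic_process_def split_beta')
qed

text \<open>Independence of \<open>T\<close> from all of \<open>F\<close>, not merely from the
  variables \<open>X t\<close>, gives \<open>(T \<omega>, \<omega>)\<close> a product law on
  \<open>ST \<Otimes>\<^sub>M F\<close>. As \<open>X\<close> is jointly measurable over
  \<open>F\<close>, the event in question is the preimage of a measurable set \<open>Q\<close> of
  that product, and integrating the sections of \<open>Q\<close> over \<open>PT\<close> yields the
  kernel.\<close>

lemma (in prob_space) has_cond_distr_random_time:
  assumes F: "subalgebra M F" "measurable_process F ST SX X"
    and T: "T \<in> M \<rightarrow>\<^sub>M ST" "distr M ST T = PT"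
    and indep: "indep_set {T -` W \<inter> space M | W. W \<in> sets ST} (sets F)"
    and D: "\<And>t. t \<in> space ST \<Longrightarrow> distr M SX (X t) = D t"
  shows "has_cond_distr M ST SX D PT T (\<lambda>\<omega>. X (T \<omega>) \<omega>)"
  unfolding has_cond_distr_def
proof (intro ballI)
  fix A W assume A[measurable]: "A \<in> sets SX" and W[measurable]: "W \<in> sets ST"
  have space_F: "space F = space M"
    using F(1) by (simp add: subalgebra_def)
  have sets_PT: "sets PT = sets ST" and space_PT: "space PT = space ST"
    using T(2) by auto
  have id: "(\<lambda>\<omega>. \<omega>) \<in> M \<rightarrow>\<^sub>M F"
    by (rule measurable_from_subalg[OF F(1)]) simp
  have X[measurable]: "(\<lambda>(t, \<omega>). X t \<omega>) \<in> ST \<Otimes>\<^sub>M F \<rightarrow>\<^sub>M SX"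
    using F(2) by (simp add: measurable_process_def)
  \<comment> \<open>\<open>R\<close> is \<open>M\<close> restricted to the events of
    \<open>F\<close>, realised as the image of \<open>M\<close> under the identity.\<close>
  define R where "R = distr M F (\<lambda>\<omega>. \<omega>)"
  interpret R: prob_space R
    unfolding R_def by (rule prob_space_distr) fact
  have R: "emeasure R B = emeasure M B" if "B \<in> sets F" for B
    using that sets.sets_into_space[OF that] space_F id
    by (simp add: R_def emeasure_distr Int_absorb2)
  \<comment> \<open>Agreement on rectangles suffices, and on \<open>V \<times> B\<close> it is
    exactly the independence of \<open>T\<close> and \<open>F\<close>.\<close>
  have joint: "PT \<Otimes>\<^sub>M R = distr M (ST \<Otimes>\<^sub>M F) (\<lambda>\<omega>. (T \<omega>, \<omega>))"
  proof (rule pair_measure_eqI)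
    show "sigma_finite_measure PT"
      using prob_space_distr[OF T(1)] T(2) by (simp add: prob_space_imp_sigma_finite)
    show "sigma_finite_measure R" ..
    show "sets (PT \<Otimes>\<^sub>M R) = sets (distr M (ST \<Otimes>\<^sub>M F) (\<lambda>\<omega>. (T \<omega>, \<omega>)))"
      by (simp add: R_def sets_PT cong: sets_pair_measure_cong)
    fix V B assume "V \<in> sets PT" "B \<in> sets R"
    then have V: "V \<in> sets ST" and B: "B \<in> sets F"
      by (simp_all add: sets_PT R_def)
    have "emeasure PT V * emeasure R B = ennreal (prob (T -` V \<inter> space M) * prob B)"
      using V B by (simp add: R T(2)[symmetric] emeasure_distr T(1) emeasure_eq_measure ennreal_mult)
    also have "prob (T -` V \<inter> space M) * prob B = prob ((T -` V \<inter> space M) \<inter> B)"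
      using V B by (intro indep_setD[OF indep, symmetric]) auto
    also have "(T -` V \<inter> space M) \<inter> B = (\<lambda>\<omega>. (T \<omega>, \<omega>)) -` (V \<times> B) \<inter> space M"
      by auto
    also have "ennreal (prob \<dots>) = emeasure (distr M (ST \<Otimes>\<^sub>M F) (\<lambda>\<omega>. (T \<omega>, \<omega>))) (V \<times> B)"
      using V B T(1) id by (simp add: emeasure_distr emeasure_eq_measure)
    finally show "emeasure PT V * emeasure R B =
        emeasure (distr M (ST \<Otimes>\<^sub>M F) (\<lambda>\<omega>. (T \<omega>, \<omega>))) (V \<times> B)" .
  qed
  define Q where "Q = {p \<in> space (ST \<Otimes>\<^sub>M F). X (fst p) (snd p) \<in> A \<and> fst p \<in> W}"
  have Q: "Q \<in> sets (ST \<Otimes>\<^sub>M F)"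
    unfolding Q_def using X by measurable
  \<comment> \<open>For \<open>t\<close> in \<open>W\<close> the section is the event that
    \<open>X t\<close> lies in \<open>A\<close>; for other \<open>t\<close> it is empty, hence the
    indicator.\<close>
  have slice: "emeasure R (Pair t -` Q) = emeasure (D t) A * indicator W t" if t: "t \<in> space ST" for t
  proof -
    have Xt: "X t \<in> F \<rightarrow>\<^sub>M SX"
      using F(2) t by (simp add: measurable_process_def stochastic_process_def)
    have eq: "Pair t -` Q = (if t \<in> W then X t -` A \<inter> space F else {})"
      using t by (auto simp: Q_def space_pair_measure)
    show ?thesis
      using measurable_sets[OF Xt A] Xt
      by (auto simp: eq R space_F D[OF t, symmetric] emeasure_distr measurable_from_subalg[OF F(1)])
  qed
  have "emeasure M {\<omega> \<in> space M. X (T \<omega>) \<omega> \<in> A \<and> T \<omega> \<in> W} =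
      emeasure M ((\<lambda>\<omega>. (T \<omega>, \<omega>)) -` Q \<inter> space M)"
    using measurable_space[OF T(1)]
    by (intro arg_cong[where f = "emeasure M"]) (auto simp: Q_def space_pair_measure space_F)
  also have "\<dots> = emeasure (PT \<Otimes>\<^sub>M R) Q"
    unfolding joint using T(1) id Q by (simp add: emeasure_distr)
  also have "\<dots> = (\<integral>\<^sup>+t. emeasure R (Pair t -` Q) \<partial>PT)"
    using Q by (intro R.emeasure_pair_measure_alt)
      (simp add: R_def sets_PT cong: sets_pair_measure_cong)
  also have "\<dots> = (\<integral>\<^sup>+t\<in>W. emeasure (D t) A \<partial>PT)"
    by (intro nn_integral_cong) (simp add: slice space_PT)
  finally show "emeasure M {\<omega> \<in> space M. X (T \<omega>) \<omega> \<in> A \<and> T \<omega> \<in> W} =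
    (\<integral>\<^sup>+t\<in>W. emeasure (D t) A \<partial>PT)" .
qed

text \<open>The condition fixes the joint law on all rectangles \<open>W \<times> A\<close>, an
  intersection-stable generator of the product, and its right-hand side depends only on
  \<open>D\<close> and \<open>PT\<close>. Applied to two indices, this makes the pairs identically
  distributed.\<close>

lemma (in prob_space) has_cond_distr_unique:
  assumes "has_cond_distr M ST SX D PT T Y" "has_cond_distr M ST SX D PT T' Y'"
    and [measurable]: "T \<in> M \<rightarrow>\<^sub>M ST" "Y \<in> M \<rightarrow>\<^sub>M SX" "T' \<in> M \<rightarrow>\<^sub>M ST" "Y' \<in> M \<rightarrow>\<^sub>M SX"
  shows "distr M (ST \<Otimes>\<^sub>M SX) (\<lambda>\<omega>. (T \<omega>, Y \<omega>)) = distr M (ST \<Otimes>\<^sub>M SX) (\<lambda>\<omega>. (T' \<omega>, Y' \<omega>))"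
    (is "?L = ?R")
proof (rule measure_eqI_generator_eq[OF Int_stable_pair_measure_generator[of ST SX],
      where \<Omega> = "space ST \<times> space SX" and A = "\<lambda>_. space ST \<times> space SX"])
  interpret L: prob_space ?L by (rule prob_space_distr) measurable
  show "emeasure ?L (space ST \<times> space SX) \<noteq> \<infinity>" by simp
  fix C assume "C \<in> {a \<times> b | a b. a \<in> sets ST \<and> b \<in> sets SX}"
  then obtain W A where C: "C = W \<times> A" and WA[measurable]: "W \<in> sets ST" "A \<in> sets SX"
    by auto
  have vimage: "(\<lambda>\<omega>. (U \<omega>, Z \<omega>)) -` C \<inter> space M = {\<omega> \<in> space M. Z \<omega> \<in> A \<and> U \<omega> \<in> W}"
    for U :: "'a \<Rightarrow> 'b" and Z :: "'a \<Rightarrow> 'c"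
    by (auto simp: C)
  show "emeasure ?L C = emeasure ?R C"
    using assms(1,2) WA unfolding has_cond_distr_def
    by (subst (1 2) emeasure_distr) (auto simp: vimage[unfolded C] C)
qed (use pair_measure_closed[of ST SX] in \<open>auto simp: sets_pair_measure\<close>)

text \<open>Each pair depends only on its own process and its own time, that is, on the block
  \<open>{Inl i, Inr i}\<close> of the sum index. Grouping an independent family of pi-systems into
  disjoint blocks preserves independence, and so does passing to the smaller families of events of
  the pairs.\<close>

lemma (in prob_space) indep_vars_random_time:
  assumes F: "\<And>i. subalgebra M (F i)" "\<And>i. measurable_process (F i) ST SX (X i)"
    and T: "\<And>i. T i \<in> M \<rightarrow>\<^sub>M ST"
    and indep: "indep_sets (case_sum (\<lambda>i. sets (F i)) (\<lambda>j. {T j -` W \<inter> space M | W. W \<in> sets ST}))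
      (UNIV :: ('i + 'i) set)"
  shows "indep_vars (\<lambda>_. ST \<Otimes>\<^sub>M SX) (\<lambda>i \<omega>. (T i \<omega>, X i (T i \<omega>) \<omega>)) (UNIV :: 'i set)"
proof -
  let ?E = "case_sum (\<lambda>i. sets (F i)) (\<lambda>j. {T j -` W \<inter> space M | W. W \<in> sets ST})"
  define G where "G i = sigma (space M) (\<Union>k\<in>{Inl i, Inr i}. ?E k)" for i
  have E_Pow: "(\<Union>k\<in>{Inl i, Inr i}. ?E k) \<subseteq> Pow (space M)" for i
    using sets.sets_into_space[of _ "F i"] F(1)[of i] by (auto simp: subalgebra_def)
  have sets_G: "sets (G i) = sigma_sets (space M) (\<Union>k\<in>{Inl i, Inr i}. ?E k)" for i
    unfolding G_def by (rule sets_measure_of[OF E_Pow])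
  have space_G: "space (G i) = space M" for i
    unfolding G_def by (rule space_measure_of[OF E_Pow])
  have G_indep: "indep_sets (\<lambda>i. sets (G i)) UNIV"
    unfolding sets_G
  proof (rule indep_sets_collect_sigma)
    show "indep_sets ?E (\<Union>i\<in>UNIV. {Inl i, Inr i})"
      using indep by (rule indep_sets_mono_index[rotated]) simp
    show "disjoint_family_on (\<lambda>i. {Inl i, Inr i}) UNIV"
      by (auto simp: disjoint_family_on_def)
    \<comment> \<open>Grouping rests on a pi-lambda argument, so each family must be closed under
      intersection; preimages under one \<open>T i\<close> are, since they commute with
      intersections.\<close>
    have "Int_stable {T i -` W \<inter> space M | W. W \<in> sets ST}" for i
    proof (rule Int_stableI)
      fix a b assume "a \<in> {T i -` W \<inter> space M | W. W \<in> sets ST}"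
        "b \<in> {T i -` W \<inter> space M | W. W \<in> sets ST}"
      then obtain V W where "V \<in> sets ST" "W \<in> sets ST"
        "a = T i -` V \<inter> space M" "b = T i -` W \<inter> space M"
        by auto
      then have "a \<inter> b = T i -` (V \<inter> W) \<inter> space M" "V \<inter> W \<in> sets ST"
        by auto
      then show "a \<inter> b \<in> {T i -` W \<inter> space M | W. W \<in> sets ST}"
        by blast
    qed
    moreover have "Int_stable (sets (F i))" for i
      by (rule Int_stableI) auto
    ultimately show "Int_stable (?E k)" if "k \<in> {Inl i, Inr i}" for i k
      using that by auto
  qed
  \<comment> \<open>Measurability is wanted for \<open>G i\<close> rather than for \<open>M\<close>,
    so that every event of the pair lies in \<open>G i\<close> and inherits independence.\<close>
  have TX: "(\<lambda>\<omega>. (T i \<omega>, X i (T i \<omega>) \<omega>)) \<in> G i \<rightarrow>\<^sub>M ST \<Otimes>\<^sub>M SX" for i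
  proof -
    have Ti: "T i \<in> G i \<rightarrow>\<^sub>M ST"
      using measurable_space[OF T[of i]]
      by (intro measurableI) (auto simp: sets_G space_G intro!: sigma_sets.Basic)
    have "subalgebra (G i) (F i)"
      using F(1)[of i] by (auto simp: subalgebra_def space_G sets_G intro!: sigma_sets.Basic)
    then have "measurable_process (G i) ST SX (X i)"
      using F(2) by (rule measurable_process_mono)
    then show ?thesis
      by (rule measurable_Pair[OF Ti measurable_process_random_time[OF _ Ti]])
  qed
  have sets_G_M: "sets (G i) \<subseteq> events" for i
    using G_indep by (auto simp: indep_sets_def)
  show ?thesis
    unfolding indep_vars_def2
  proof (intro conjI ballI)
    fix i :: 'i
    have "subalgebra M (G i)"
      using sets_G_M space_G by (simp add: subalgebra_def)
    then show "random_variable (ST \<Otimes>\<^sub>M SX) (\<lambda>\<omega>. (T i \<omega>, X i (T i \<omega>) \<omega>))"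
      using TX by (rule measurable_from_subalg)
  next
    show "indep_sets (\<lambda>i. {(\<lambda>\<omega>. (T i \<omega>, X i (T i \<omega>) \<omega>)) -` A \<inter> space M | A.
        A \<in> sets (ST \<Otimes>\<^sub>M SX)}) (UNIV :: 'i set)"
      by (rule indep_sets_mono_sets[OF G_indep]) (use measurable_sets[OF TX] in \<open>auto simp: space_G\<close>)
  qed
qed

theorem theorem1:
  fixes M :: "'w measure" and ST :: "'t measure" and SX :: "'x measure"
    and X :: "nat \<Rightarrow> 't \<Rightarrow> 'w \<Rightarrow> 'x" and T :: "nat \<Rightarrow> 'w \<Rightarrow> 't"
    and PT :: "'t measure" and D :: "'t \<Rightarrow> 'x measure"
  assumes "prob_space M"
    and "countably_generated ST" and "countably_generated SX"
    and "\<And>i. measurable_process M ST SX (X i)"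
    and "\<And>i j. process_law M ST SX (X i) = process_law M ST SX (X j)"
    and "prob_space PT" and "sets PT = sets ST"
    and "\<And>i. T i \<in> M \<rightarrow>\<^sub>M ST" and "\<And>i. distr M ST (T i) = PT"
    and "indep_processes_and_times M ST SX X T"
    and "\<And>i t. t \<in> space ST \<Longrightarrow> distr M SX (X i t) = D t"
  shows "drift_process ST SX D PT
    \<and> drift_process_sample M ST SX D PT T (\<lambda>i \<omega>. X i (T i \<omega>) \<omega>)
    \<and> (\<forall>i. \<not> has_drift D PT \<longleftrightarrow>
          (\<exists>N\<in>null_sets PT. stationary_on M SX (space ST - N) (X i)))"
proof -
  note X = assms(4) and T = assms(8,9) and D = assms(11)
  interpret prob_space M by fact
  have drift: "drift_process ST SX D PT"
    using assms(6,7) measurable_process_kernel[OF assms(1) X D] by (simp add: drift_process_def)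
  obtain F where F: "\<And>i. subalgebra M (F i)" "\<And>i. measurable_process (F i) ST SX (X i)"
    and indep: "indep_sets (case_sum (\<lambda>i. sets (F i)) (\<lambda>j. {T j -` W \<inter> space M | W. W \<in> sets ST}))
      (UNIV :: (nat + nat) set)" (is "indep_sets ?E UNIV")
    using assms(10) by (auto simp: indep_processes_and_times_def)
  have cond: "has_cond_distr M ST SX D PT (T i) (\<lambda>\<omega>. X i (T i \<omega>) \<omega>)" for i
  proof (rule has_cond_distr_random_time[OF F T _ D])
    show "indep_set {T i -` W \<inter> space M | W. W \<in> sets ST} (sets (F i))"
      unfolding indep_sets2_eq
    proof (intro conjI ballI)
      fix a b assume "a \<in> {T i -` W \<inter> space M | W. W \<in> sets ST}" "b \<in> sets (F i)"
      \<comment> \<open>Factorisation over the two indices, with \<open>a\<close> at the time index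
        and \<open>b\<close> at the process index, is the product rule for \<open>a\<close> and
        \<open>b\<close>.\<close>
      then have "\<forall>k\<in>{Inr i, Inl i}. case_sum (\<lambda>_. b) (\<lambda>_. a) k \<in> ?E k"
        by simp
      from indep_setsD[OF indep _ _ _ this] show "prob (a \<inter> b) = prob a * prob b"
        by simp
    qed (use F(1)[of i] T(1)[of i] in \<open>auto simp: subalgebra_def\<close>)
  qed
  have "iid_vars M (ST \<Otimes>\<^sub>M SX) (\<lambda>i \<omega>. (T i \<omega>, X i (T i \<omega>) \<omega>))"
    unfolding iid_vars_def
  proof (intro conjI allI)
    show "distr M (ST \<Otimes>\<^sub>M SX) (\<lambda>\<omega>. (T i \<omega>, X i (T i \<omega>) \<omega>)) =
        distr M (ST \<Otimes>\<^sub>M SX) (\<lambda>\<omega>. (T j \<omega>, X j (T j \<omega>) \<omega>))" for i j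
      by (rule has_cond_distr_unique[OF cond cond]) (rule T(1) measurable_process_random_time[OF X T(1)])+
  qed (rule indep_vars_random_time[OF F T(1) indep])
  then have sample: "drift_process_sample M ST SX D PT T (\<lambda>i \<omega>. X i (T i \<omega>) \<omega>)"
    using cond T by (simp add: drift_process_sample_def)
  \<comment> \<open>Comparing two kernel values event by event is the stationarity condition between
    two times, so stationarity off \<open>N\<close> becomes constancy of \<open>D\<close> off
    \<open>N\<close>. All \<open>X i t\<close> share the law \<open>D t\<close>, hence any
    \<open>i\<close> will do.\<close>
  have "D s = D t \<longleftrightarrow> (\<forall>A\<in>sets SX.
      measure M {\<omega>\<in>space M. X i t \<omega> \<in> A} = measure M {\<omega>\<in>space M. X i s \<omega> \<in> A})"
    if st: "s \<in> space ST" "t \<in> space ST" for i s t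
  proof -
    have Xr: "X i r \<in> M \<rightarrow>\<^sub>M SX" if "r \<in> space ST" for r
      using X[of i] that by (simp add: measurable_process_def stochastic_process_def)
    have emeasure_D: "emeasure (D r) A = ennreal (measure M {\<omega>\<in>space M. X i r \<omega> \<in> A})"
      if "r \<in> space ST" "A \<in> sets SX" for r A
    proof -
      have "X i r -` A \<inter> space M = {\<omega>\<in>space M. X i r \<omega> \<in> A}"
        by auto
      then show ?thesis
        using Xr that by (simp add: D[of r i, symmetric] emeasure_distr emeasure_eq_measure)
    qed
    \<comment> \<open>Equality of measures also demands equal sigma-algebras, which
      \<open>D r\<close> has as a law on \<open>SX\<close>.\<close>
    have sets_D: "sets (D r) = sets SX" if "r \<in> space ST" for r
      by (simp add: D[OF that, of i, symmetric])
    show ?thesis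
    proof
      assume "D s = D t"
      then have "ennreal (measure M {\<omega>\<in>space M. X i t \<omega> \<in> A}) =
          ennreal (measure M {\<omega>\<in>space M. X i s \<omega> \<in> A})" if "A \<in> sets SX" for A
        using emeasure_D st that by metis
      then show "\<forall>A\<in>sets SX.
          measure M {\<omega>\<in>space M. X i t \<omega> \<in> A} = measure M {\<omega>\<in>space M. X i s \<omega> \<in> A}"
        by simp
    qed (use st sets_D emeasure_D in \<open>auto intro!: measure_eqI\<close>)
  qed
  then have "stationary_on M SX (space ST - N) (X i) \<longleftrightarrow>
      (\<forall>s\<in>space ST - N. \<forall>t\<in>space ST - N. D s = D t)" for i N
    unfolding stationary_on_def by (intro ball_cong) auto
  then show ?thesis
    using drift sample not_has_drift_iff[OF assms(3) drift] by simp
qed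

end
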